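(* Let $(G_n)_{n\in\mathbb{N}}$ be a first order convergent sequence of finite graphs and let $M$ be a modeling that is a limit of $(G_n)_{n\in\mathbb{N}}$. Then for almost every vertex $v$ of $M$ (with respect to the probability measure of $M$; i.e., the set of exceptional vertices is contained in a set of measure zero) the following holds: if $M'$ denotes the modeling $M$ rooted at $v$, then there exists a sequence $(v_n)_{n\in\mathbb{N}}$ with $v_n$ a vertex of $G_n$ such that $M'$ is a limit of the sequence $(G'_n)_{n\in\mathbb{N}}$, where $G'_n$ is $G_n$ rooted at $v_n$.
   Context: Graphs are considered as structures in the first order language with one binary (adjacency) relation; an $m$-rooted graph/modeling is a structure in the language extended by $m$ constants $c_1,\dots,c_m$, and "rooting at $v_1,\dots,v_m$" means interpreting $c_i$ as $v_i$. A modeling is a (finite or infinite) graph (or $m$-rooted graph) whose vertex set carries a probability measure such that, for every first order formula $\psi$ with $k$ free variables, the set of $k$-tuples of vertices satisfying $\psi$ is measurable in the product measure. The Stone pairing $\langle\psi,M\rangle$ is the measure of the set of $k$-tuples satisfying $\psi$ (for a sentence, it is $1$ if $M$ satisfies $\psi$ and $0$ otherwise). A finite graph is regarded as a modeling with the uniform probability measure on its vertices. A sequence $(G_n)$ of finite (rooted) graphs is first order convergent if $\lim_n\langle\psi,G_n\rangle$ exists for every first order formula $\psi$ (of the appropriate language), and a modeling $M$ is a limit of $(G_n)$ if $\lim_n\langle\psi,G_n\rangle=\langle\psi,M\rangle$ for every first order formula $\psi$. *)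

theory Defs
  imports "HOL-Probability.Probability"
begin

text \<open>
  First order formulas over one binary relation symbol and constants \<open>c\<^sub>1, c\<^sub>2, \<dots>\<close>.
  The constant \<open>c\<^sub>i\<close> is \<open>Cst (i - 1)\<close>; the language with \<open>m\<close> constants consists of the
  formulas that only mention \<open>Cst 0, \<dots>, Cst (m - 1)\<close>.
\<close>

datatype trm = Var nat | Cst nat

datatype fm =
    Eq trm trm
  | Adj trm trm
  | Neg fm
  | Conj fm fm
  | Ex nat fm

primrec vars_trm :: "trm \<Rightarrow> nat set" where
  "vars_trm (Var x) = {x}"
| "vars_trm (Cst i) = {}"

primrec consts_trm :: "trm \<Rightarrow> nat set" where
  "consts_trm (Var x) = {}"
| "consts_trm (Cst i) = {i}"

primrec fv :: "fm \<Rightarrow> nat set" where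
  "fv (Eq s t) = vars_trm s \<union> vars_trm t"
| "fv (Adj s t) = vars_trm s \<union> vars_trm t"
| "fv (Neg \<phi>) = fv \<phi>"
| "fv (Conj \<phi> \<psi>) = fv \<phi> \<union> fv \<psi>"
| "fv (Ex x \<phi>) = fv \<phi> - {x}"

primrec consts_fm :: "fm \<Rightarrow> nat set" where
  "consts_fm (Eq s t) = consts_trm s \<union> consts_trm t"
| "consts_fm (Adj s t) = consts_trm s \<union> consts_trm t"
| "consts_fm (Neg \<phi>) = consts_fm \<phi>"
| "consts_fm (Conj \<phi> \<psi>) = consts_fm \<phi> \<union> consts_fm \<psi>"
| "consts_fm (Ex x \<phi>) = consts_fm \<phi>"

definition formulas :: "nat \<Rightarrow> fm set" where
  "formulas m = {\<phi>. consts_fm \<phi> \<subseteq> {..<m}}"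

text \<open>Unrooted graphs are the rooted graphs whose list of roots is empty.\<close>

record 'a rooted_graph =
  verts :: "'a set"
  edges :: "('a \<times> 'a) set"
  roots :: "'a list"

record 'a modeling = "'a rooted_graph" +
  vmeas :: "'a measure"

definition is_graph :: "nat \<Rightarrow> ('a, 'z) rooted_graph_scheme \<Rightarrow> bool" where
  "is_graph m G \<longleftrightarrow>
     verts G \<noteq> {} \<and> edges G \<subseteq> verts G \<times> verts G \<and> sym (edges G) \<and> irrefl (edges G) \<and>
     length (roots G) = m \<and> set (roots G) \<subseteq> verts G"

definition is_finite_graph :: "nat \<Rightarrow> ('a, 'z) rooted_graph_scheme \<Rightarrow> bool" where
  "is_finite_graph m G \<longleftrightarrow> is_graph m G \<and> finite (verts G)"

definition root_at :: "('a, 'z) rooted_graph_scheme \<Rightarrow> 'a list \<Rightarrow> ('a, 'z) rooted_graph_scheme" where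
  "root_at G vs = G\<lparr>roots := vs\<rparr>"

primrec eval_trm :: "('a, 'z) rooted_graph_scheme \<Rightarrow> (nat \<Rightarrow> 'a) \<Rightarrow> trm \<Rightarrow> 'a" where
  "eval_trm G e (Var x) = e x"
| "eval_trm G e (Cst i) = roots G ! i"

primrec sat :: "('a, 'z) rooted_graph_scheme \<Rightarrow> (nat \<Rightarrow> 'a) \<Rightarrow> fm \<Rightarrow> bool" where
  "sat G e (Eq s t) \<longleftrightarrow> eval_trm G e s = eval_trm G e t"
| "sat G e (Adj s t) \<longleftrightarrow> (eval_trm G e s, eval_trm G e t) \<in> edges G"
| "sat G e (Neg \<phi>) \<longleftrightarrow> \<not> sat G e \<phi>"
| "sat G e (Conj \<phi> \<psi>) \<longleftrightarrow> sat G e \<phi> \<and> sat G e \<psi>"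
| "sat G e (Ex x \<phi>) \<longleftrightarrow> (\<exists>a\<in>verts G. sat G (e(x := a)) \<phi>)"

text \<open>
  The \<open>k\<close>-tuples of vertices at which a formula with \<open>k\<close> free variables is evaluated are
  indexed by the free variables themselves, i.e. they are the functions in
  \<open>fv \<phi> \<rightarrow>\<^sub>E verts M\<close>. For a sentence this space has exactly one element, of mass 1.
\<close>

definition tuples :: "'a modeling \<Rightarrow> fm \<Rightarrow> (nat \<Rightarrow> 'a) measure" where
  "tuples M \<phi> = PiM (fv \<phi>) (\<lambda>_. vmeas M)"

definition solutions :: "'a modeling \<Rightarrow> fm \<Rightarrow> (nat \<Rightarrow> 'a) set" where
  "solutions M \<phi> = {e \<in> fv \<phi> \<rightarrow>\<^sub>E verts M. sat M e \<phi>}"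

definition is_modeling :: "nat \<Rightarrow> 'a modeling \<Rightarrow> bool" where
  "is_modeling m M \<longleftrightarrow>
     is_graph m M \<and> prob_space (vmeas M) \<and> space (vmeas M) = verts M \<and>
     (\<forall>\<phi>\<in>formulas m. solutions M \<phi> \<in> sets (tuples M \<phi>))"

definition stone_pairing :: "fm \<Rightarrow> 'a modeling \<Rightarrow> real" where
  "stone_pairing \<phi> M = measure (tuples M \<phi>) (solutions M \<phi>)"

definition finite_modeling :: "'a rooted_graph \<Rightarrow> 'a modeling" where
  "finite_modeling G =
     \<lparr>verts = verts G, edges = edges G, roots = roots G,
      vmeas = uniform_count_measure (verts G)\<rparr>"

definition fo_convergent :: "nat \<Rightarrow> (nat \<Rightarrow> 'a rooted_graph) \<Rightarrow> bool" where
  "fo_convergent m G \<longleftrightarrow>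
     (\<forall>n. is_finite_graph m (G n)) \<and>
     (\<forall>\<phi>\<in>formulas m. convergent (\<lambda>n. stone_pairing \<phi> (finite_modeling (G n))))"

definition fo_limit :: "nat \<Rightarrow> (nat \<Rightarrow> 'a rooted_graph) \<Rightarrow> 'b modeling \<Rightarrow> bool" where
  "fo_limit m G M \<longleftrightarrow>
     (\<forall>n. is_finite_graph m (G n)) \<and> is_modeling m M \<and>
     (\<forall>\<phi>\<in>formulas m.
        (\<lambda>n. stone_pairing \<phi> (finite_modeling (G n))) \<longlonglongrightarrow> stone_pairing \<phi> M)"

lemma finite_fv: "finite (fv \<phi>)"
proof -
  have "finite (vars_trm t)" for t
    by (cases t) auto
  then show ?thesis
    by (induction \<phi>) auto
qed

lemma is_modeling_finite_modeling:
  assumes "is_finite_graph m G"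
  shows "is_modeling m (finite_modeling G)"
proof -
  have fin: "finite (verts G)" and ne: "verts G \<noteq> {}"
    using assms by (auto simp: is_finite_graph_def is_graph_def)
  have "X \<in> sets (PiM I (\<lambda>_. uniform_count_measure (verts G)))"
    if I: "finite I" and X: "X \<subseteq> I \<rightarrow>\<^sub>E verts G" for I :: "nat set" and X
  proof -
    have "finite X"
      using X fin I by (meson finite_PiE finite_subset)
    moreover have "{e} \<in> sets (PiM I (\<lambda>_. uniform_count_measure (verts G)))" if "e \<in> X" for e
    proof -
      have e: "e \<in> I \<rightarrow>\<^sub>E verts G"
        using that X by auto
      then have "{e} = (\<Pi>\<^sub>E i\<in>I. {e i})"
        by (subst PiE_singleton) (auto simp: PiE_def)
      moreover have "(\<Pi>\<^sub>E i\<in>I. {e i}) \<in> sets (PiM I (\<lambda>_. uniform_count_measure (verts G)))"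
        using e I by (intro sets_PiM_I_finite) (auto simp: sets_uniform_count_measure)
      ultimately show ?thesis by simp
    qed
    ultimately have "(\<Union>e\<in>X. {e}) \<in> sets (PiM I (\<lambda>_. uniform_count_measure (verts G)))"
      by (intro sets.finite_UN) auto
    then show ?thesis by simp
  qed
  then show ?thesis
    using assms fin ne
    by (auto simp: is_modeling_def is_finite_graph_def is_graph_def finite_modeling_def
        tuples_def solutions_def finite_fv prob_space_uniform_count_measure
        space_uniform_count_measure)
qed

lemma stone_pairing_sentence:
  assumes "fv \<phi> = {}"
  shows "stone_pairing \<phi> M = (if sat M (\<lambda>_. undefined) \<phi> then 1 else 0)"
proof -
  have "solutions M \<phi> = (if sat M (\<lambda>_. undefined) \<phi> then {\<lambda>_. undefined} else {})"
    using assms by (auto simp: solutions_def)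
  then show ?thesis
    using assms by (simp add: stone_pairing_def tuples_def PiM_empty measure_def)
qed

end

theory Submission
  imports Defs
begin

text \<open>
  To a vertex \<open>v\<close> associate its profile, the family of Stone pairings of all formulas with the
  structure rooted at \<open>v\<close>. Replacing the constant by a free variable, Fubini turns the mean of
  a coordinate of the profile of a random vertex into a Stone pairing of the unrooted structure, so
  these means converge. A product of two coordinates is again a coordinate (conjunction with
  disjoint free variables), so the means of all polynomials in the profile converge as well. High
  powers of a polynomial peaked at a rational point show that every rational ball which contains
  the profiles of a set of vertices of \<open>M\<close> of positive measure, slightly enlarged, eventually
  contains the profile of some vertex of \<open>G\<^sub>n\<close>. There are countably many formulas and rational
  balls, so almost every profile in \<open>M\<close> lies only in balls of positive measure, and a
  diagonal choice of vertices gives the sequence of roots.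
\<close>

section \<open>Renaming of variables and constants\<close>

instance trm :: countable
  by countable_datatype

instance fm :: countable
  by countable_datatype

primrec ren_trm :: "(nat \<Rightarrow> nat) \<Rightarrow> (nat \<Rightarrow> trm) \<Rightarrow> trm \<Rightarrow> trm" where
  "ren_trm r c (Var x) = Var (r x)"
| "ren_trm r c (Cst i) = c i"

text \<open>Bound variables are renamed like free ones, so no capture occurs when \<open>r\<close>
  is injective and its range avoids the variables of the terms \<open>c i\<close>.\<close>

primrec ren :: "(nat \<Rightarrow> nat) \<Rightarrow> (nat \<Rightarrow> trm) \<Rightarrow> fm \<Rightarrow> fm" where
  "ren r c (Eq s t) = Eq (ren_trm r c s) (ren_trm r c t)"
| "ren r c (Adj s t) = Adj (ren_trm r c s) (ren_trm r c t)"
| "ren r c (Neg \<phi>) = Neg (ren r c \<phi>)"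
| "ren r c (Conj \<phi> \<psi>) = Conj (ren r c \<phi>) (ren r c \<psi>)"
| "ren r c (Ex x \<phi>) = Ex (r x) (ren r c \<phi>)"

lemma eval_trm_cong:
  "(\<And>x. x \<in> vars_trm t \<Longrightarrow> e x = e' x) \<Longrightarrow> eval_trm G e t = eval_trm G e' t"
  by (cases t) auto

lemma sat_cong:
  "(\<And>x. x \<in> fv \<phi> \<Longrightarrow> e x = e' x) \<Longrightarrow> sat G e \<phi> \<longleftrightarrow> sat G e' \<phi>"
proof (induction \<phi> arbitrary: e e')
  case (Eq s t)
  then have "eval_trm G e s = eval_trm G e' s" "eval_trm G e t = eval_trm G e' t"
    by (auto intro!: eval_trm_cong)
  then show ?case by simp
next
  case (Adj s t)
  then have "eval_trm G e s = eval_trm G e' s" "eval_trm G e t = eval_trm G e' t"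
    by (auto intro!: eval_trm_cong)
  then show ?case by simp
next
  case (Neg \<phi>)
  from Neg.IH[of e e'] Neg.prems show ?case by simp
next
  case (Conj \<phi> \<psi>)
  from Conj.IH(1)[of e e'] Conj.IH(2)[of e e'] Conj.prems show ?case by simp
next
  case (Ex x \<phi>)
  have "sat G (e(x := a)) \<phi> \<longleftrightarrow> sat G (e'(x := a)) \<phi>" for a
    using Ex.prems by (intro Ex.IH) auto
  then show ?case by simp
qed

text \<open>Injectivity turns an update of \<open>e\<close> at \<open>r x\<close> into an update of
  \<open>e \<circ> r\<close> at \<open>x\<close>, and \<open>disj\<close> shields the terms
  \<open>c i\<close> from quantifiers. \<open>G'\<close> may differ from \<open>G\<close> in its
  roots.\<close>

lemma sat_ren:
  assumes r: "inj r" and same: "verts G' = verts G" "edges G' = edges G"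
    and disj: "\<And>i x. r x \<notin> vars_trm (c i)"
    and "\<And>i. i \<in> consts_fm \<phi> \<Longrightarrow> eval_trm G e (c i) = roots G' ! i"
  shows "sat G e (ren r c \<phi>) \<longleftrightarrow> sat G' (e \<circ> r) \<phi>"
  using assms(5)
proof (induction \<phi> arbitrary: e)
  case (Eq s t)
  have "eval_trm G e (ren_trm r c u) = eval_trm G' (e \<circ> r) u" if "u = s \<or> u = t" for u
    using that Eq by (cases u) auto
  then show ?case by (simp add: comp_def)
next
  case (Adj s t)
  have "eval_trm G e (ren_trm r c u) = eval_trm G' (e \<circ> r) u" if "u = s \<or> u = t" for u
    using that Adj by (cases u) auto
  then show ?case by (simp add: same comp_def)
next
  case (Ex x \<phi>)
  have "sat G (e(r x := a)) (ren r c \<phi>) \<longleftrightarrow> sat G' ((e \<circ> r)(x := a)) \<phi>" for a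
  proof -
    have "eval_trm G (e(r x := a)) (c i) = eval_trm G e (c i)" for i
      using disj by (intro eval_trm_cong) auto
    then have "sat G (e(r x := a)) (ren r c \<phi>) \<longleftrightarrow> sat G' (e(r x := a) \<circ> r) \<phi>"
      using Ex.prems by (intro Ex.IH) (simp del: fun_upd_apply)
    also have "e(r x := a) \<circ> r = (e \<circ> r)(x := a)"
      using r by (auto simp: fun_eq_iff inj_eq)
    finally show ?thesis .
  qed
  then show ?case by (simp add: same comp_def)
qed simp_all

lemma fv_ren:
  assumes "inj r" and "\<And>i x. r x \<notin> vars_trm (c i)"
  shows "fv (ren r c \<phi>) = r ` fv \<phi> \<union> (\<Union>i\<in>consts_fm \<phi>. vars_trm (c i))"
proof -
  have "vars_trm (ren_trm r c t) = r ` vars_trm t \<union> (\<Union>i\<in>consts_trm t. vars_trm (c i))" for t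
    by (cases t) auto
  then show ?thesis
    using assms by (induction \<phi>) (auto simp: image_Un image_set_diff)
qed

lemma consts_ren: "consts_fm (ren r c \<phi>) = (\<Union>i\<in>consts_fm \<phi>. consts_trm (c i))"
proof -
  have "consts_trm (ren_trm r c t) = (\<Union>i\<in>consts_trm t. consts_trm (c i))" for t
    by (cases t) auto
  then show ?thesis
    by (induction \<phi>) auto
qed

section \<open>Unit, product and unrooting of formulas\<close>

definition tt :: fm where
  "tt = Ex 0 (Eq (Var 0) (Var 0))"

text \<open>Even and odd variables keep the free variables of the factors apart, while the constants
  stay shared.\<close>

definition mul :: "fm \<Rightarrow> fm \<Rightarrow> fm" where
  "mul \<phi> \<psi> = Conj (ren (\<lambda>x. 2 * x) Cst \<phi>) (ren (\<lambda>x. 2 * x + 1) Cst \<psi>)"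

text \<open>The trivial equation makes the variable replacing the root occur freely even if the root
  itself does not occur in the formula.\<close>

definition unroot :: "fm \<Rightarrow> fm" where
  "unroot \<phi> = Conj (ren Suc (\<lambda>_. Var 0) \<phi>) (Eq (Var 0) (Var 0))"

lemma tt_formulas: "tt \<in> formulas m"
  by (simp add: tt_def formulas_def)

lemma mul_formulas: "\<phi> \<in> formulas m \<Longrightarrow> \<psi> \<in> formulas m \<Longrightarrow> mul \<phi> \<psi> \<in> formulas m"
  by (auto simp: mul_def formulas_def consts_ren)

lemma unroot_formulas: "unroot \<phi> \<in> formulas 0"
  by (auto simp: unroot_def formulas_def consts_ren)

lemma fv_unroot: "fv (unroot \<phi>) = insert 0 (Suc ` fv \<phi>)"
  by (auto simp: unroot_def fv_ren)

lemma sat_unroot: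
  assumes "\<phi> \<in> formulas 1"
  shows "sat M e (unroot \<phi>) \<longleftrightarrow> sat (root_at M [e 0]) (e \<circ> Suc) \<phi>"
proof -
  have "sat M e (ren Suc (\<lambda>_. Var 0) \<phi>) \<longleftrightarrow> sat (root_at M [e 0]) (e \<circ> Suc) \<phi>"
    using assms by (intro sat_ren) (auto simp: root_at_def formulas_def)
  then show ?thesis by (simp add: unroot_def)
qed

section \<open>Stone pairings of modelings\<close>

lemma modelingD:
  assumes "is_modeling m M"
  shows "prob_space (vmeas M)" "space (vmeas M) = verts M" "verts M \<noteq> {}"
    and "\<phi> \<in> formulas m \<Longrightarrow> solutions M \<phi> \<in> sets (PiM (fv \<phi>) (\<lambda>_. vmeas M))"
  using assms by (auto simp: is_modeling_def is_graph_def tuples_def)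

lemma root_at_simps [simp]:
  "verts (root_at M vs) = verts M" "edges (root_at M vs) = edges M"
  "roots (root_at M vs) = vs" "vmeas (root_at N vs) = vmeas N"
  by (simp_all add: root_at_def)

text \<open>The solution set of \<open>\<phi>\<close> is the preimage of that of
  \<open>unroot \<phi>\<close> under a measurable map: \<open>g\<close> shifts the tuple by one
  place and puts \<open>v\<close> at 0.\<close>

lemma is_modeling_root_at:
  assumes M: "is_modeling 0 M" and v: "v \<in> verts M"
  shows "is_modeling 1 (root_at M [v])"
proof -
  have "solutions (root_at M [v]) \<phi> \<in> sets (PiM (fv \<phi>) (\<lambda>_. vmeas M))"
    if \<phi>: "\<phi> \<in> formulas 1" for \<phi>
  proof -
    define g where "g e = (\<lambda>j\<in>fv (unroot \<phi>). case j of 0 \<Rightarrow> v | Suc i \<Rightarrow> e i)" for e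
    have "g \<in> measurable (PiM (fv \<phi>) (\<lambda>_. vmeas M)) (PiM (fv (unroot \<phi>)) (\<lambda>_. vmeas M))"
      unfolding g_def using v modelingD(2)[OF M]
      by (intro measurable_restrict) (auto simp: fv_unroot)
    then have "g -` solutions M (unroot \<phi>) \<inter> space (PiM (fv \<phi>) (\<lambda>_. vmeas M))
        \<in> sets (PiM (fv \<phi>) (\<lambda>_. vmeas M))"
      using modelingD(4)[OF M unroot_formulas] by (rule measurable_sets)
    moreover have "sat M (g e) (unroot \<phi>) \<longleftrightarrow> sat (root_at M [v]) e \<phi>" for e
    proof -
      have "sat M (g e) (unroot \<phi>) \<longleftrightarrow> sat (root_at M [v]) (g e \<circ> Suc) \<phi>"
        using sat_unroot[OF \<phi>, of M "g e"] by (simp add: g_def fv_unroot)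
      also have "\<dots> \<longleftrightarrow> sat (root_at M [v]) e \<phi>"
        by (rule sat_cong) (auto simp: g_def fv_unroot)
      finally show ?thesis .
    qed
    moreover have "g e \<in> fv (unroot \<phi>) \<rightarrow>\<^sub>E verts M" if "e \<in> fv \<phi> \<rightarrow>\<^sub>E verts M" for e
      using that v by (auto simp: g_def fv_unroot PiE_def Pi_def)
    ultimately have "{e \<in> fv \<phi> \<rightarrow>\<^sub>E verts M. sat (root_at M [v]) e \<phi>}
        \<in> sets (PiM (fv \<phi>) (\<lambda>_. vmeas M))"
      using modelingD(2)[OF M]
      by (elim back_subst[of "\<lambda>A. A \<in> _"]) (auto simp: solutions_def space_PiM)
    then show ?thesis by (simp add: solutions_def)
  qed
  then show ?thesis
    using M v by (auto simp: is_modeling_def is_graph_def tuples_def)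
qed

lemma stone_pairing_bounds:
  assumes "is_modeling m M"
  shows "0 \<le> stone_pairing \<phi> M" "stone_pairing \<phi> M \<le> 1"
proof -
  interpret prob_space "PiM (fv \<phi>) (\<lambda>_. vmeas M)"
    using modelingD(1)[OF assms] by (intro prob_space_PiM)
  show "0 \<le> stone_pairing \<phi> M" "stone_pairing \<phi> M \<le> 1"
    by (simp_all add: stone_pairing_def tuples_def)
qed

lemma stone_pairing_tt: "verts M \<noteq> {} \<Longrightarrow> stone_pairing tt M = 1"
  by (subst stone_pairing_sentence) (auto simp: tt_def)

text \<open>Reindexing a power of one measure along an injection preserves it. This absorbs the
  variable shifts made by \<open>mul\<close> and \<open>unroot\<close>.\<close>

lemma emeasure_reindex:
  fixes M :: "'a modeling" and r :: "nat \<Rightarrow> nat"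
  assumes M: "is_modeling m M" and \<phi>: "\<phi> \<in> formulas m" and r: "inj r"
  defines "A \<equiv> {e \<in> r ` fv \<phi> \<rightarrow>\<^sub>E verts M. sat M (e \<circ> r) \<phi>}"
  shows "A \<in> sets (PiM (r ` fv \<phi>) (\<lambda>_. vmeas M))"
    and "emeasure (PiM (r ` fv \<phi>) (\<lambda>_. vmeas M)) A = ennreal (stone_pairing \<phi> M)"
proof -
  interpret prob_space "vmeas M" using M by (rule modelingD)
  interpret P: prob_space "PiM (fv \<phi>) (\<lambda>_. vmeas M)" by (intro prob_space_PiM prob_space_axioms)
  define g where "g e = (\<lambda>n\<in>fv \<phi>. e (r n))" for e :: "nat \<Rightarrow> 'a"
  let ?I = "PiM (r ` fv \<phi>) (\<lambda>_. vmeas M)" and ?K = "PiM (fv \<phi>) (\<lambda>_. vmeas M)"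
  have meas: "g \<in> measurable ?I ?K"
    unfolding g_def by (intro measurable_restrict) auto
  have distr: "distr ?I ?K g = ?K"
    unfolding g_def
    using distr_PiM_reindex[of "r ` fv \<phi>" "\<lambda>_. vmeas M" r "fv \<phi>"] r prob_space_axioms
    by (auto intro: inj_on_subset)
  have sol: "solutions M \<phi> \<in> sets ?K"
    using M \<phi> by (rule modelingD)
  have "sat M (g e) \<phi> \<longleftrightarrow> sat M (e \<circ> r) \<phi>" for e
    by (rule sat_cong) (auto simp: g_def)
  then have A: "A = g -` solutions M \<phi> \<inter> space ?I"
    using modelingD(2)[OF M] by (auto simp: A_def solutions_def space_PiM g_def PiE_def Pi_def)
  show "A \<in> sets ?I"
    unfolding A using meas sol by (rule measurable_sets)
  have "emeasure ?I A = emeasure (distr ?I ?K g) (solutions M \<phi>)"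
    unfolding A using meas sol by (simp add: emeasure_distr)
  then show "emeasure ?I A = ennreal (stone_pairing \<phi> M)"
    by (simp add: distr stone_pairing_def tuples_def P.emeasure_eq_measure)
qed

text \<open>The even and the odd coordinates are independent: split by \<open>merge\<close>, the
  solution set becomes the rectangle \<open>A \<times> B\<close>.\<close>

lemma stone_pairing_mul:
  assumes M: "is_modeling m M" and \<phi>: "\<phi> \<in> formulas m" and \<psi>: "\<psi> \<in> formulas m"
  shows "stone_pairing (mul \<phi> \<psi>) M = stone_pairing \<phi> M * stone_pairing \<psi> M"
proof -
  interpret prob_space "vmeas M" using M by (rule modelingD)
  interpret product_sigma_finite "\<lambda>_::nat. vmeas M"
    by (simp add: product_sigma_finite_def sigma_finite_measure_axioms)
  define r s :: "nat \<Rightarrow> nat" where "r x = 2 * x" and "s x = 2 * x + 1" for x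
  have inj: "inj r" "inj s" by (auto simp: r_def s_def inj_def)
  define I J where "I = r ` fv \<phi>" and "J = s ` fv \<psi>"
  define A where "A = {e \<in> I \<rightarrow>\<^sub>E verts M. sat M (e \<circ> r) \<phi>}"
  define B where "B = {e \<in> J \<rightarrow>\<^sub>E verts M. sat M (e \<circ> s) \<psi>}"
  have disj: "I \<inter> J = {}"
    unfolding I_def J_def r_def s_def by auto presburger
  have fin: "finite I" "finite J" by (auto simp: I_def J_def finite_fv)
  interpret I: prob_space "PiM I (\<lambda>_. vmeas M)" by (intro prob_space_PiM prob_space_axioms)
  interpret J: prob_space "PiM J (\<lambda>_. vmeas M)" by (intro prob_space_PiM prob_space_axioms)
  interpret IJ: prob_space "PiM (I \<union> J) (\<lambda>_. vmeas M)" by (intro prob_space_PiM prob_space_axioms)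
  let ?IJ = "PiM (I \<union> J) (\<lambda>_. vmeas M)"
  note A = emeasure_reindex[OF M \<phi> inj(1), folded I_def, folded A_def]
  note B = emeasure_reindex[OF M \<psi> inj(2), folded J_def, folded B_def]
  have mul: "mul \<phi> \<psi> = Conj (ren r Cst \<phi>) (ren s Cst \<psi>)"
    by (simp add: mul_def r_def[abs_def] s_def[abs_def])
  have fv: "fv (mul \<phi> \<psi>) = I \<union> J"
    using inj by (simp add: mul fv_ren I_def J_def)
  have "sat M e (mul \<phi> \<psi>) \<longleftrightarrow> sat M (e \<circ> r) \<phi> \<and> sat M (e \<circ> s) \<psi>" for e
    using inj by (simp add: mul sat_ren[where G' = M])
  then have sol: "solutions M (mul \<phi> \<psi>)
      = {e \<in> I \<union> J \<rightarrow>\<^sub>E verts M. sat M (e \<circ> r) \<phi> \<and> sat M (e \<circ> s) \<psi>}"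
    by (simp add: solutions_def fv)
  have sol_meas: "solutions M (mul \<phi> \<psi>) \<in> sets ?IJ"
    using modelingD(4)[OF M mul_formulas[OF \<phi> \<psi>]] by (simp add: fv)
  have mI: "sat M (merge I J (x, y) \<circ> r) \<phi> \<longleftrightarrow> sat M (x \<circ> r) \<phi>" for x y
    by (rule sat_cong) (auto simp: I_def merge_def)
  \<comment> \<open>\<open>merge\<close> consults \<open>I\<close> first, so disjointness ensures
    that it returns \<open>y\<close> on \<open>J\<close>.\<close>
  have mJ: "sat M (merge I J (x, y) \<circ> s) \<psi> \<longleftrightarrow> sat M (y \<circ> s) \<psi>" for x y
    using disj by (intro sat_cong) (auto simp: J_def merge_def)
  have "merge I J -` solutions M (mul \<phi> \<psi>) \<inter>
      space (PiM I (\<lambda>_. vmeas M) \<Otimes>\<^sub>M PiM J (\<lambda>_. vmeas M)) = A \<times> B"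
    using modelingD(2)[OF M] disj
    by (auto simp: sol A_def B_def space_pair_measure space_PiM mI mJ)
  then have "emeasure ?IJ (solutions M (mul \<phi> \<psi>))
      = emeasure (PiM I (\<lambda>_. vmeas M) \<Otimes>\<^sub>M PiM J (\<lambda>_. vmeas M)) (A \<times> B)"
    using distr_merge[OF disj fin] sol_meas
    by (metis emeasure_distr measurable_merge)
  also have "\<dots> = ennreal (stone_pairing \<phi> M * stone_pairing \<psi> M)"
    using A B stone_pairing_bounds[OF M]
    by (simp add: J.emeasure_pair_measure_Times ennreal_mult)
  finally show ?thesis
    using stone_pairing_bounds[OF M]
    by (simp add: stone_pairing_def[of "mul \<phi> \<psi>"] tuples_def fv IJ.emeasure_eq_measure)
qed

section \<open>Profiles of vertices\<close>

definition profile :: "'a modeling \<Rightarrow> 'a \<Rightarrow> fm \<Rightarrow> real" where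
  "profile M v \<phi> = stone_pairing \<phi> (root_at M [v])"

text \<open>Tonelli on the solution set of \<open>unroot \<phi>\<close>: its section with coordinate
  0 equal to \<open>v\<close> has measure \<open>profile M v \<phi>\<close>. The same computation
  yields measurability in \<open>v\<close>.\<close>

lemma profile_integral:
  assumes M: "is_modeling 0 M" and \<phi>: "\<phi> \<in> formulas 1"
  shows "integrable (vmeas M) (\<lambda>v. profile M v \<phi>)"
    and "(LINT v|vmeas M. profile M v \<phi>) = stone_pairing (unroot \<phi>) M"
proof -
  interpret prob_space "vmeas M" using M by (rule modelingD)
  interpret product_sigma_finite "\<lambda>_::nat. vmeas M"
    by (simp add: product_sigma_finite_def sigma_finite_measure_axioms)
  define I where "I = Suc ` fv \<phi>"
  have I: "finite I" "0 \<notin> I" by (auto simp: I_def finite_fv)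
  interpret I: prob_space "PiM I (\<lambda>_. vmeas M)" by (intro prob_space_PiM prob_space_axioms)
  interpret I0: prob_space "PiM (insert 0 I) (\<lambda>_. vmeas M)"
    by (intro prob_space_PiM prob_space_axioms)
  let ?S = "solutions M (unroot \<phi>)"
  have S: "?S \<in> sets (PiM (insert 0 I) (\<lambda>_. vmeas M))"
    using modelingD(4)[OF M unroot_formulas, of \<phi>] by (simp add: fv_unroot I_def)
  have inner: "(\<integral>\<^sup>+x. indicator ?S (x(0 := v)) \<partial>PiM I (\<lambda>_. vmeas M)) = ennreal (profile M v \<phi>)"
    if v: "v \<in> space (vmeas M)" for v
  proof -
    have v': "v \<in> verts M" using v modelingD(2)[OF M] by simp
    define A where "A = {e \<in> I \<rightarrow>\<^sub>E verts M. sat (root_at M [v]) (e \<circ> Suc) \<phi>}"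
    have A: "A \<in> sets (PiM I (\<lambda>_. vmeas M))"
      "emeasure (PiM I (\<lambda>_. vmeas M)) A = ennreal (profile M v \<phi>)"
      using emeasure_reindex[OF is_modeling_root_at[OF M v'] \<phi>, of Suc]
      by (simp_all add: A_def I_def profile_def)
    have "x(0 := v) \<in> ?S \<longleftrightarrow> x \<in> A" if "x \<in> space (PiM I (\<lambda>_. vmeas M))" for x
    proof -
      have x: "x \<in> I \<rightarrow>\<^sub>E verts M" using that modelingD(2)[OF M] by (simp add: space_PiM)
      then have "x(0 := v) \<in> insert 0 I \<rightarrow>\<^sub>E verts M"
        using v' by (auto simp: PiE_def extensional_def)
      moreover have "x(0 := v) \<circ> Suc = x \<circ> Suc" by auto
      ultimately show ?thesis
        using x sat_unroot[OF \<phi>, of M "x(0 := v)"]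
        by (simp add: A_def solutions_def fv_unroot I_def[symmetric])
    qed
    then have "(\<integral>\<^sup>+x. indicator ?S (x(0 := v)) \<partial>PiM I (\<lambda>_. vmeas M))
        = (\<integral>\<^sup>+x. indicator A x \<partial>PiM I (\<lambda>_. vmeas M))"
      by (intro nn_integral_cong) (auto simp: indicator_def)
    then show ?thesis using A by simp
  qed
  have "(\<lambda>(v, x). x(0 := v)) \<in> measurable (vmeas M \<Otimes>\<^sub>M PiM I (\<lambda>_. vmeas M))
      (PiM (insert 0 I) (\<lambda>_. vmeas M))"
    using measurable_compose[OF measurable_pair_swap' measurable_add_dim[of 0 I "\<lambda>_. vmeas M"]]
    by (simp add: case_prod_unfold)
  then have "(\<lambda>v. \<integral>\<^sup>+x. indicator ?S (x(0 := v)) \<partial>PiM I (\<lambda>_. vmeas M))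
      \<in> borel_measurable (vmeas M)"
    using S by (intro I.borel_measurable_nn_integral)
      (auto simp: case_prod_unfold intro!: measurable_compose[where g = "indicator ?S"])
  then have "(\<lambda>v. ennreal (profile M v \<phi>)) \<in> borel_measurable (vmeas M)"
    by (subst measurable_cong[OF inner[symmetric]])
  \<comment> \<open>Stone pairings are nonnegative, so \<open>enn2real\<close> recovers the profile
    itself.\<close>
  then have "(\<lambda>v. enn2real (ennreal (profile M v \<phi>))) \<in> borel_measurable (vmeas M)"
    by measurable
  then have meas: "(\<lambda>v. profile M v \<phi>) \<in> borel_measurable (vmeas M)"
    by (simp add: profile_def stone_pairing_def)
  have bounds: "0 \<le> profile M v \<phi>" "profile M v \<phi> \<le> 1" if "v \<in> space (vmeas M)" for v
    using stone_pairing_bounds[OF is_modeling_root_at[OF M, of v]] that modelingD(2)[OF M]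
    by (auto simp: profile_def)
  show int: "integrable (vmeas M) (\<lambda>v. profile M v \<phi>)"
    using meas bounds by (intro integrable_const_bound[of _ 1]) auto
  have "ennreal (stone_pairing (unroot \<phi>) M) = emeasure (PiM (insert 0 I) (\<lambda>_. vmeas M)) ?S"
    by (simp add: stone_pairing_def tuples_def fv_unroot I_def I0.emeasure_eq_measure[unfolded I_def])
  also have "\<dots> = (\<integral>\<^sup>+v. \<integral>\<^sup>+x. indicator ?S (x(0 := v)) \<partial>PiM I (\<lambda>_. vmeas M) \<partial>vmeas M)"
    using product_nn_integral_insert_rev[OF I, of "indicator ?S"] S by simp
  also have "\<dots> = (\<integral>\<^sup>+v. ennreal (profile M v \<phi>) \<partial>vmeas M)"
    using inner by (rule nn_integral_cong)
  also have "\<dots> = ennreal (LINT v|vmeas M. profile M v \<phi>)"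
    using int bounds by (intro nn_integral_eq_integral) auto
  finally show "(LINT v|vmeas M. profile M v \<phi>) = stone_pairing (unroot \<phi>) M"
    using stone_pairing_bounds[OF M, of "unroot \<phi>"] bounds
    by (metis ennreal_inj integral_nonneg_AE AE_I2)
qed

section \<open>Convergence of polynomial observables of a random root\<close>

text \<open>Isolates properties shared by all profiles, so that identities between observables can
  be checked pointwise, for one \<open>x\<close> at a time.\<close>

definition character :: "(fm \<Rightarrow> real) \<Rightarrow> bool" where
  "character x \<longleftrightarrow> x tt = 1 \<and> (\<forall>\<phi>\<in>formulas 1. 0 \<le> x \<phi> \<and> x \<phi> \<le> 1) \<and>
     (\<forall>\<phi>\<in>formulas 1. \<forall>\<psi>\<in>formulas 1. x (mul \<phi> \<psi>) = x \<phi> * x \<psi>)"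

lemma character_profile:
  assumes "is_modeling 0 M" "v \<in> space (vmeas M)"
  shows "character (profile M v)"
proof -
  have "is_modeling 1 (root_at M [v])"
    using assms modelingD(2)[OF assms(1)] by (intro is_modeling_root_at) auto
  from modelingD(3)[OF this] stone_pairing_bounds[OF this] stone_pairing_mul[OF this]
  show ?thesis
    by (auto simp: character_def profile_def stone_pairing_tt)
qed

text \<open>These are the real polynomials in the coordinates \<open>x \<phi>\<close>.\<close>

inductive_set observables :: "((fm \<Rightarrow> real) \<Rightarrow> real) set" where
  gen: "\<phi> \<in> formulas 1 \<Longrightarrow> (\<lambda>x. x \<phi>) \<in> observables"
| const: "(\<lambda>x. c) \<in> observables"
| add: "g \<in> observables \<Longrightarrow> h \<in> observables \<Longrightarrow> (\<lambda>x. g x + h x) \<in> observables"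
| mult: "g \<in> observables \<Longrightarrow> h \<in> observables \<Longrightarrow> (\<lambda>x. g x * h x) \<in> observables"

lemma observables_diff:
  assumes "g \<in> observables" "h \<in> observables"
  shows "(\<lambda>x. g x - h x) \<in> observables"
  using observables.add[OF assms(1) observables.mult[OF observables.const[of "-1"] assms(2)]]
  by simp

lemma observables_power: "h \<in> observables \<Longrightarrow> (\<lambda>x. h x ^ N) \<in> observables"
  by (induction N) (auto intro: observables.intros)

lemma observables_sum:
  "(\<And>i. i \<in> I \<Longrightarrow> h i \<in> observables) \<Longrightarrow> (\<lambda>x. \<Sum>i\<in>I. h i x) \<in> observables"
  by (induction I rule: infinite_finite_induct) (auto intro: observables.intros)

locale modeling_limit =
  fixes F :: "nat \<Rightarrow> 'a modeling" and M :: "'b modeling"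
  assumes F: "\<And>n. is_modeling 0 (F n)" and M: "is_modeling 0 M"
    and lim: "\<And>\<phi>. \<phi> \<in> formulas 0 \<Longrightarrow>
      (\<lambda>n. stone_pairing \<phi> (F n)) \<longlonglongrightarrow> stone_pairing \<phi> M"
begin

text \<open>Integrability is carried along because additivity of the integral relies on it.\<close>

definition conv :: "((fm \<Rightarrow> real) \<Rightarrow> real) \<Rightarrow> bool" where
  "conv h \<longleftrightarrow> (\<forall>n. integrable (vmeas (F n)) (\<lambda>w. h (profile (F n) w))) \<and>
     integrable (vmeas M) (\<lambda>v. h (profile M v)) \<and>
     (\<lambda>n. LINT w|vmeas (F n). h (profile (F n) w)) \<longlonglongrightarrow> (LINT v|vmeas M. h (profile M v))"

lemma conv_cong:
  assumes "\<And>x. character x \<Longrightarrow> g x = h x"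
  shows "conv g \<longleftrightarrow> conv h"
proof -
  have 1: "g (profile (F n) w) = h (profile (F n) w)" if "w \<in> space (vmeas (F n))" for n w
    using that by (intro assms character_profile F)
  have 2: "g (profile M v) = h (profile M v)" if "v \<in> space (vmeas M)" for v
    using that by (intro assms character_profile M)
  show ?thesis
    using 1 2 by (simp add: conv_def cong: Bochner_Integration.integrable_cong
        Bochner_Integration.integral_cong)
qed

lemma conv_gen: "\<phi> \<in> formulas 1 \<Longrightarrow> conv (\<lambda>x. x \<phi>)"
  using F M lim[OF unroot_formulas] by (simp add: conv_def profile_integral)

lemma conv_add: "conv g \<Longrightarrow> conv h \<Longrightarrow> conv (\<lambda>x. g x + h x)"
  by (auto simp: conv_def intro: tendsto_add)

lemma conv_scale: "conv h \<Longrightarrow> conv (\<lambda>x. c * h x)"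
  by (auto simp: conv_def intro: tendsto_mult_left)

text \<open>Convergence alone is not visibly preserved by products; carrying along an arbitrary factor
  \<open>h\<close> and an arbitrary generator makes the induction go through, since the product of two
  generators is a generator again.\<close>

lemma conv_observables_aux:
  assumes "g \<in> observables" and "\<And>\<phi>. \<phi> \<in> formulas 1 \<Longrightarrow> conv (\<lambda>x. h x * x \<phi>)"
    and "\<phi> \<in> formulas 1"
  shows "conv (\<lambda>x. g x * h x * x \<phi>)"
  using assms
proof (induction g arbitrary: h \<phi> rule: observables.induct)
  case (gen \<psi>)
  have "conv (\<lambda>x. h x * x (mul \<psi> \<phi>))"
    using gen by (simp add: mul_formulas)
  then show ?case
    by (rule conv_cong[THEN iffD1, rotated]) (use gen in \<open>simp add: character_def\<close>)
next
  case (const c)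
  then show ?case
    using conv_scale[of "\<lambda>x. h x * x \<phi>" c] by (simp add: mult.assoc)
next
  case (add g1 g2)
  then show ?case
    using conv_add[of "\<lambda>x. g1 x * h x * x \<phi>" "\<lambda>x. g2 x * h x * x \<phi>"]
    by (simp add: distrib_right)
next
  case (mult g1 g2)
  \<comment> \<open>The factor passed to \<open>g1\<close> is \<open>g2 x * h x\<close>; its premise
    is the induction hypothesis for \<open>g2\<close>.\<close>
  show ?case
    using mult.IH(1)[of "\<lambda>x. g2 x * h x" \<phi>] mult.IH(2)[of h] mult.prems
    by (simp add: mult.assoc)
qed

lemma conv_observables:
  assumes "g \<in> observables"
  shows "conv g"
proof -
  \<comment> \<open>Take the factor 1 and the generator \<open>tt\<close>, which has value 1 on
    every character.\<close>
  have "conv (\<lambda>x. g x * 1 * x tt)"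
    using assms by (rule conv_observables_aux) (auto simp: conv_gen tt_formulas)
  then show ?thesis
    by (rule conv_cong[THEN iffD1, rotated]) (simp add: character_def)
qed

text \<open>A high power of \<open>h\<close> has larger mean in \<open>M\<close> than it could have in \<open>F n\<close> if \<open>h\<close>
  were everywhere at most \<open>a\<close> there.\<close>

lemma eventually_exists_large:
  assumes h: "h \<in> observables" and bounds: "\<And>x. character x \<Longrightarrow> 0 \<le> h x"
    and ab: "0 \<le> a" "a < b"
    and pos: "measure (vmeas M) {v \<in> space (vmeas M). b < h (profile M v)} > 0"
  shows "\<forall>\<^sub>F n in sequentially. \<exists>w\<in>verts (F n). a < h (profile (F n) w)"
proof -
  interpret M: prob_space "vmeas M" using M by (rule modelingD)
  let ?B = "{v \<in> space (vmeas M). b < h (profile M v)}"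
  let ?p = "measure (vmeas M) ?B"
  have "(\<lambda>v. h (profile M v)) \<in> borel_measurable (vmeas M)"
    using conv_observables[OF h] by (auto simp: conv_def)
  then have B: "?B \<in> sets (vmeas M)" by measurable
  \<comment> \<open>As \<open>a / b < 1\<close>, some power falls below the positive mass
    \<open>?p\<close>; this fixes the exponent.\<close>
  have "(\<lambda>N. (a / b) ^ N) \<longlonglongrightarrow> 0"
    using ab by (intro LIMSEQ_power_zero) auto
  from order_tendstoD(2)[OF this pos] obtain N where "(a / b) ^ N < ?p"
    by (auto simp: eventually_sequentially)
  then have N: "a ^ N < b ^ N * ?p"
    using ab by (simp add: power_divide pos_divide_less_eq mult.commute)
  have cN: "conv (\<lambda>x. h x ^ N)"
    by (intro conv_observables observables_power h)
  \<comment> \<open>A Markov-type bound: on \<open>?B\<close> the integrand is at least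
    \<open>b ^ N\<close>, elsewhere it is nonnegative.\<close>
  have "b ^ N * ?p = (LINT v|vmeas M. b ^ N * indicator ?B v)"
    using B by simp
  also have "\<dots> \<le> (LINT v|vmeas M. h (profile M v) ^ N)"
  proof (intro integral_mono)
    fix v assume "v \<in> space (vmeas M)"
    then show "b ^ N * indicator ?B v \<le> h (profile M v) ^ N"
      using bounds[OF character_profile[OF M, of v]] ab
      by (auto simp: indicator_def intro!: power_mono)
  qed (use B cN in \<open>auto simp: conv_def M.emeasure_eq_measure\<close>)
  finally have "a ^ N < (LINT v|vmeas M. h (profile M v) ^ N)"
    using N by linarith
  then have "\<forall>\<^sub>F n in sequentially. a ^ N < (LINT w|vmeas (F n). h (profile (F n) w) ^ N)"
    using cN by (auto simp: conv_def intro: order_tendstoD)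
  then show ?thesis
  proof eventually_elim
    case (elim n)
    show ?case
    proof (rule ccontr)
      interpret F: prob_space "vmeas (F n)" using F by (rule modelingD)
      assume "\<not> (\<exists>w\<in>verts (F n). a < h (profile (F n) w))"
      then have "h (profile (F n) w) ^ N \<le> a ^ N" if "w \<in> space (vmeas (F n))" for w
        using that bounds[OF character_profile[OF F that]] modelingD(2)[OF F]
        by (intro power_mono) (auto simp: not_less)
      then have "(LINT w|vmeas (F n). h (profile (F n) w) ^ N) \<le> a ^ N"
        using cN by (intro F.integral_le_const) (auto simp: conv_def)
      with elim show False by simp
    qed
  qed
qed

section \<open>Approximating the profile of almost every root\<close>

text \<open>Squares, rather than absolute values, make this a polynomial in the coordinates;
  rational centres keep the family of balls countable.\<close>

definition sq_dist :: "(nat \<Rightarrow> fm) \<Rightarrow> rat list \<Rightarrow> (fm \<Rightarrow> real) \<Rightarrow> real" where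
  "sq_dist \<phi> qs x = (\<Sum>i<length qs. (x (\<phi> i) - of_rat (qs ! i))\<^sup>2)"

text \<open>The factor in front of the squared distance keeps the function positive on characters, whose
  coordinates lie between 0 and 1.\<close>

definition bump :: "(nat \<Rightarrow> fm) \<Rightarrow> rat list \<Rightarrow> (fm \<Rightarrow> real) \<Rightarrow> real" where
  "bump \<phi> qs x = 1 - inverse (1 + (\<Sum>i<length qs. (1 + \<bar>of_rat (qs ! i)\<bar>)\<^sup>2)) * sq_dist \<phi> qs x"

lemma bump_observable:
  assumes "\<And>i. \<phi> i \<in> formulas 1"
  shows "bump \<phi> qs \<in> observables"
  unfolding bump_def[abs_def] sq_dist_def
  using assms
  by (intro observables_diff observables_sum observables_power observables.intros)

text \<open>A number in the unit interval is at distance at most \<open>1 + \<bar>q\<bar>\<close>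
  from \<open>q\<close>; the leading 1 of the normalising constant makes the inequality
  strict.\<close>

lemma bump_pos:
  assumes "\<And>i. \<phi> i \<in> formulas 1" and x: "character x"
  shows "0 < bump \<phi> qs x"
proof -
  let ?K = "1 + (\<Sum>i<length qs. (1 + \<bar>of_rat (qs ! i)\<bar>)\<^sup>2) :: real"
  have "(x (\<phi> i) - of_rat (qs ! i))\<^sup>2 \<le> (1 + \<bar>of_rat (qs ! i)\<bar>)\<^sup>2" for i
  proof -
    have "0 \<le> x (\<phi> i)" "x (\<phi> i) \<le> 1" using assms by (auto simp: character_def)
    then have "\<bar>x (\<phi> i) - of_rat (qs ! i)\<bar> \<le> \<bar>1 + \<bar>of_rat (qs ! i)\<bar>\<bar>" by linarith
    then show ?thesis by (rule abs_le_square_iff[THEN iffD1])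
  qed
  then have "sq_dist \<phi> qs x < ?K"
    unfolding sq_dist_def by (smt (verit) sum_mono)
  moreover have "0 < ?K"
    by (intro add_pos_nonneg sum_nonneg) auto
  ultimately show ?thesis by (simp add: bump_def field_simps)
qed

lemma bump_less_iff:
  "1 - inverse (1 + (\<Sum>i<length qs. (1 + \<bar>of_rat (qs ! i)\<bar>)\<^sup>2)) * c < bump \<phi> qs x \<longleftrightarrow>
    sq_dist \<phi> qs x < c"
proof -
  have "0 < 1 + (\<Sum>i<length qs. (1 + \<bar>of_rat (qs ! i)\<bar>)\<^sup>2 :: real)"
    by (intro add_pos_nonneg sum_nonneg) auto
  then show ?thesis by (simp add: bump_def)
qed

text \<open>Only points of null superlevel sets violate the implication, and rational centres and
  thresholds leave countably many such sets to discard.\<close>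

lemma AE_bump:
  fixes \<phi> :: "nat \<Rightarrow> fm"
  assumes "\<And>i. \<phi> i \<in> formulas 1"
  shows "AE v in vmeas M. \<forall>qs. \<forall>b::rat. of_rat b < bump \<phi> qs (profile M v) \<longrightarrow>
    measure (vmeas M) {v \<in> space (vmeas M). of_rat b < bump \<phi> qs (profile M v)} > 0"
proof -
  interpret M: prob_space "vmeas M" using M by (rule modelingD)
  have "AE v in vmeas M. of_rat b < bump \<phi> qs (profile M v) \<longrightarrow>
      measure (vmeas M) {v \<in> space (vmeas M). of_rat b < bump \<phi> qs (profile M v)} > 0"
    for qs and b :: rat
  proof (cases "measure (vmeas M) {v \<in> space (vmeas M). of_rat b < bump \<phi> qs (profile M v)} > 0")
    case False
    have "(\<lambda>v. bump \<phi> qs (profile M v)) \<in> borel_measurable (vmeas M)"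
      using conv_observables[OF bump_observable[of \<phi> qs]] assms by (auto simp: conv_def)
    then have "{v \<in> space (vmeas M). of_rat b < bump \<phi> qs (profile M v)} \<in> sets (vmeas M)"
      by measurable
    then have "{v \<in> space (vmeas M). of_rat b < bump \<phi> qs (profile M v)} \<in> null_sets (vmeas M)"
      using False by (simp add: null_sets_def M.emeasure_eq_measure zero_less_measure_iff)
    from AE_not_in[OF this] AE_space show ?thesis
      by eventually_elim simp
  qed simp
  then show ?thesis
    by (simp add: AE_all_countable)
qed

text \<open>A small rational ball around the profile of \<open>v\<close> has positive measure by
  \<open>AE_bump\<close>, so \<open>eventually_exists_large\<close> finds a vertex of
  \<open>F n\<close> in a slightly larger ball. One null set serves all \<open>k\<close> and
  \<open>\<epsilon>\<close>.\<close>

lemma AE_profile_approx: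
  fixes \<phi> :: "nat \<Rightarrow> fm"
  assumes \<phi>: "\<And>i. \<phi> i \<in> formulas 1"
  shows "AE v in vmeas M. \<forall>k. \<forall>\<epsilon>>0. \<forall>\<^sub>F n in sequentially.
    \<exists>w\<in>verts (F n). \<forall>i<k. \<bar>profile (F n) w (\<phi> i) - profile M v (\<phi> i)\<bar> < \<epsilon>"
  using AE_bump[of \<phi>, OF \<phi>] AE_space
proof eventually_elim
  case (elim v)
  let ?x = "profile M v"
  show ?case
  proof (intro allI impI)
    fix k :: nat and \<epsilon> :: real
    assume \<epsilon>: "\<epsilon> > 0"
    \<comment> \<open>The squares of \<open>k\<close> errors of size \<open>\<eta>\<close> must sum
      to less than \<open>(\<epsilon> / 2)\<^sup>2\<close>; \<open>real k + 1\<close> keeps the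
      denominator positive for \<open>k = 0\<close>.\<close>
    define \<eta> where "\<eta> = \<epsilon> / (2 * (real k + 1))"
    have \<eta>: "\<eta> > 0" "\<eta> \<le> \<epsilon> / 2" "real k * \<eta>\<^sup>2 < (\<epsilon> / 2)\<^sup>2"
    proof -
      show "\<eta> > 0" using \<epsilon> by (simp add: \<eta>_def)
      show "\<eta> \<le> \<epsilon> / 2" using \<epsilon> by (simp add: \<eta>_def field_simps)
      have "real k * 4 < (2 + real k * 2)\<^sup>2"
        by (simp add: power2_eq_square algebra_simps add_pos_nonneg)
      then show "real k * \<eta>\<^sup>2 < (\<epsilon> / 2)\<^sup>2"
        using \<epsilon> by (simp add: \<eta>_def power_divide power_mult_distrib field_simps)
    qed
    have "\<exists>q::rat. \<bar>?x (\<phi> i) - of_rat q\<bar> < \<eta>" for i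
    proof -
      obtain q where "?x (\<phi> i) < of_rat q" "of_rat q < ?x (\<phi> i) + \<eta>"
        using of_rat_dense[of "?x (\<phi> i)" "?x (\<phi> i) + \<eta>"] \<eta> by auto
      then show ?thesis by (intro exI[of _ q]) auto
    qed
    then obtain q where q: "\<And>i. \<bar>?x (\<phi> i) - of_rat (q i :: rat)\<bar> < \<eta>" by metis
    define qs where "qs = map q [0..<k]"
    define K :: real where "K = 1 + (\<Sum>i<length qs. (1 + \<bar>of_rat (qs ! i)\<bar>)\<^sup>2)"
    \<comment> \<open>The threshold for radius \<open>\<epsilon> / 2\<close>, cut off at 0 because
      \<open>eventually_exists_large\<close> takes powers of \<open>a\<close>.\<close>
    define a where "a = max 0 (1 - inverse K * (\<epsilon> / 2)\<^sup>2)"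
    have "(?x (\<phi> i) - of_rat (q i))\<^sup>2 \<le> \<eta>\<^sup>2" for i
      using q[of i] by (intro abs_le_square_iff[THEN iffD1]) linarith
    then have "sq_dist \<phi> qs ?x \<le> (\<Sum>i<k. \<eta>\<^sup>2)"
      unfolding sq_dist_def qs_def by (simp add: sum_mono del: sum_constant)
    also have "\<dots> < (\<epsilon> / 2)\<^sup>2" using \<eta> by simp
    finally have "a < bump \<phi> qs ?x"
      using bump_less_iff[of qs "(\<epsilon> / 2)\<^sup>2" \<phi> ?x] bump_pos[of \<phi>, OF \<phi> character_profile[OF M elim(2)], of qs]
      by (simp add: a_def K_def)
    \<comment> \<open>\<open>AE_bump\<close> speaks of rational thresholds, and the comparison of
      powers needs a gap above \<open>a\<close>.\<close>
    then obtain b :: rat where b: "a < of_rat b" "of_rat b < bump \<phi> qs ?x"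
      using of_rat_dense by blast
    have "\<forall>\<^sub>F n in sequentially. \<exists>w\<in>verts (F n). a < bump \<phi> qs (profile (F n) w)"
      using elim b bump_pos[OF \<phi>]
      by (intro eventually_exists_large[of _ a "of_rat b"] bump_observable[OF \<phi>])
        (auto simp: a_def less_imp_le)
    then show "\<forall>\<^sub>F n in sequentially.
        \<exists>w\<in>verts (F n). \<forall>i<k. \<bar>profile (F n) w (\<phi> i) - ?x (\<phi> i)\<bar> < \<epsilon>"
    proof (rule eventually_mono, elim bexE, intro bexI allI impI)
      fix n w i
      assume w: "a < bump \<phi> qs (profile (F n) w)" and i: "i < k"
      \<comment> \<open>One square is at most the whole sum; the triangle inequality through
        \<open>q i\<close> then costs \<open>\<epsilon> / 2\<close> plus less than
        \<open>\<eta>\<close>.\<close>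
      have "(profile (F n) w (\<phi> i) - of_rat (qs ! i))\<^sup>2 \<le> sq_dist \<phi> qs (profile (F n) w)"
        unfolding sq_dist_def using i
        by (intro member_le_sum[of i, where f = "\<lambda>i. (profile (F n) w (\<phi> i) - of_rat (qs ! i))\<^sup>2"])
          (auto simp: qs_def)
      also have "\<dots> < (\<epsilon> / 2)\<^sup>2"
        using w bump_less_iff[of qs "(\<epsilon> / 2)\<^sup>2" \<phi>] by (simp add: a_def K_def)
      finally have "\<bar>profile (F n) w (\<phi> i) - of_rat (q i)\<bar> < \<epsilon> / 2"
        using i \<epsilon>
        by (intro power2_less_imp_less[of _ "\<epsilon> / 2"]) (simp_all add: qs_def)
      then show "\<bar>profile (F n) w (\<phi> i) - ?x (\<phi> i)\<bar> < \<epsilon>"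
        using q[of i] \<eta>(2) by linarith
    qed
  qed
qed

end

section \<open>Diagonal choice of the roots\<close>

lemma diagonal_choice:
  fixes P :: "nat \<Rightarrow> nat \<Rightarrow> 'w \<Rightarrow> bool"
  assumes ev: "\<And>k. \<forall>\<^sub>F n in sequentially. \<exists>w\<in>V n. P k n w"
    and anti: "\<And>j k n w. j \<le> k \<Longrightarrow> P k n w \<Longrightarrow> P j n w"
    and ne: "\<And>n. V n \<noteq> {}"
  shows "\<exists>w. (\<forall>n. w n \<in> V n) \<and> (\<forall>k. \<forall>\<^sub>F n in sequentially. P k n (w n))"
proof -
  \<comment> \<open>At \<open>n\<close> the witness for the largest good \<open>k\<close> is taken;
    by \<open>anti\<close> it serves all smaller ones. The bound \<open>k \<le> n\<close> makes the
    good \<open>k\<close> finite in number, while each fixed \<open>k\<close> is good for all large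
    \<open>n\<close>.\<close>
  define good where "good n k \<longleftrightarrow> k \<le> n \<and> (\<exists>w\<in>V n. P k n w)" for n k :: nat
  have "\<exists>w\<in>V n. \<forall>k. good n k \<longrightarrow> P k n w" for n
  proof (cases "\<exists>k. good n k")
    case True
    define K where "K = Max {k. good n k}"
    have fin: "finite {k. good n k}"
      by (rule finite_subset[of _ "{..n}"]) (auto simp: good_def)
    then have "good n K" using Max_in[OF fin] True by (auto simp: K_def)
    then obtain w where w: "w \<in> V n" "P K n w" by (auto simp: good_def)
    have "P k n w" if "good n k" for k
      using that anti[OF _ w(2), of k] Max_ge[OF fin, of k] by (simp add: K_def)
    with w show ?thesis by blast
  next
    case False
    \<comment> \<open>With no good \<open>k\<close> there is no constraint, and any vertex will
      do.\<close>
    then show ?thesis using ne[of n] by blast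
  qed
  then obtain w where w: "\<And>n. w n \<in> V n" "\<And>n k. good n k \<Longrightarrow> P k n (w n)" by metis
  have "\<forall>\<^sub>F n in sequentially. P k n (w n)" for k
    using ev[of k] eventually_ge_at_top[of k]
    by eventually_elim (auto intro!: w(2) simp: good_def)
  with w show ?thesis by blast
qed

theorem theorem2:
  fixes G :: "nat \<Rightarrow> 'a rooted_graph" and M :: "'b modeling"
  assumes "\<And>n. is_finite_graph 0 (G n)"
    and "fo_convergent 0 G"
    and "is_modeling 0 M"
    and "fo_limit 0 G M"
  shows "AE v in vmeas M.
           \<exists>w. (\<forall>n. w n \<in> verts (G n)) \<and>
               fo_limit 1 (\<lambda>n. root_at (G n) [w n]) (root_at M [v])"
proof -
  let ?F = "\<lambda>n. finite_modeling (G n)"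
  interpret modeling_limit ?F M
    using assms by unfold_locales (auto simp: fo_limit_def is_modeling_finite_modeling)
  \<comment> \<open>There are countably many formulas, so this enumerates all of
    \<open>formulas 1\<close>.\<close>
  define \<phi> where "\<phi> = from_nat_into (formulas 1)"
  have ne: "formulas 1 \<noteq> {}" using tt_formulas by blast
  have \<phi>: "\<phi> i \<in> formulas 1" for i
    unfolding \<phi>_def using ne by (rule from_nat_into)
  show ?thesis
    using AE_profile_approx[of \<phi>, OF \<phi>] AE_space
  proof eventually_elim
    case (elim v)
    have v: "v \<in> verts M" using elim modelingD(2)[OF assms(3)] by simp
    \<comment> \<open>One index \<open>k\<close> governs both the number of coordinates and the
      tolerance, which makes \<open>P\<close> antitone in \<open>k\<close>.\<close>
    define P where "P k n w \<longleftrightarrow>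
      (\<forall>i<k. \<bar>profile (?F n) w (\<phi> i) - profile M v (\<phi> i)\<bar> < 1 / Suc k)" for k n w
    have "\<exists>w. (\<forall>n. w n \<in> verts (G n)) \<and> (\<forall>k. \<forall>\<^sub>F n in sequentially. P k n (w n))"
    proof (rule diagonal_choice)
      show "\<forall>\<^sub>F n in sequentially. \<exists>w\<in>verts (G n). P k n w" for k
        using elim(1)[rule_format, of "1 / Suc k" k] by (simp add: P_def finite_modeling_def)
      show "P j n w" if "j \<le> k" "P k n w" for j k n w
        unfolding P_def
      proof (intro allI impI)
        fix i assume "i < j"
        then have "\<bar>profile (?F n) w (\<phi> i) - profile M v (\<phi> i)\<bar> < 1 / Suc k"
          using that by (simp add: P_def)
        also have "\<dots> \<le> 1 / Suc j" using that by (simp add: field_simps)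
        finally show "\<bar>profile (?F n) w (\<phi> i) - profile M v (\<phi> i)\<bar> < 1 / Suc j" .
      qed
      show "verts (G n) \<noteq> {}" for n
        using assms(1)[of n] by (simp add: is_finite_graph_def is_graph_def)
    qed
    then obtain w where w: "\<And>n. w n \<in> verts (G n)"
      and ev: "\<And>k. \<forall>\<^sub>F n in sequentially. P k n (w n)" by blast
    \<comment> \<open>Rooting commutes with adding the uniform measure, so profiles of
      \<open>?F n\<close> are Stone pairings of the rooted graphs.\<close>
    have fm: "finite_modeling (root_at (G n) [w n]) = root_at (?F n) [w n]" for n
      by (simp add: finite_modeling_def root_at_def)
    have "(\<lambda>n. stone_pairing \<psi> (finite_modeling (root_at (G n) [w n])))
        \<longlonglongrightarrow> stone_pairing \<psi> (root_at M [v])" if \<psi>: "\<psi> \<in> formulas 1" for \<psi>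
    proof -
      obtain i where i: "\<psi> = \<phi> i"
        using from_nat_into_surj[OF _ \<psi>] by (auto simp: \<phi>_def)
      have "(\<lambda>n. profile (?F n) (w n) \<psi>) \<longlonglongrightarrow> profile M v \<psi>"
      proof (rule LIMSEQ_I)
        fix \<epsilon> :: real assume "\<epsilon> > 0"
        then obtain j where j: "1 / Suc j < \<epsilon>" using nat_approx_posE by metis
        \<comment> \<open>\<open>Suc i\<close> puts coordinate \<open>i\<close> among the first
          \<open>k\<close>, and \<open>j\<close> secures the tolerance.\<close>
        define k where "k = max (Suc i) j"
        have "1 / Suc k \<le> 1 / Suc j" by (simp add: k_def field_simps)
        with j have k: "1 / Suc k < \<epsilon>" by linarith
        show "\<exists>N. \<forall>n\<ge>N. norm (profile (?F n) (w n) \<psi> - profile M v \<psi>) < \<epsilon>"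
          using ev[of k] k unfolding eventually_sequentially P_def i
          by (metis k_def less_trans lessI max.strict_coboundedI1 real_norm_def)
      qed
      then show ?thesis by (simp add: profile_def fm)
    qed
    moreover have "is_finite_graph 1 (root_at (G n) [w n])" for n
      using assms(1)[of n] w[of n] by (auto simp: is_finite_graph_def is_graph_def)
    ultimately show ?case
      using w is_modeling_root_at[OF assms(3) v] by (auto simp: fo_limit_def)
  qed
qed

end
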